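(* Let $n,d$ be positive integers and $q$ a prime power. For the $(\mathcal{MU}_q(n,d),\mathcal{R}_d(q))$-bimodule $\mathcal{MT}_q(n,d)$ we have an isomorphism of algebras $$ \mathrm{End}_{ \mathcal{R}_d(q)}(\mathcal{MT}_q(n,d))\simeq\mathcal{MU}_q(n,d).$$
   Context: Let $\mathbb{F}_q$ be the field with $q$ elements, $G_d=\mathrm{GL}_d(\mathbb{F}_q)$, $B_d\subseteq G_d$ the subgroup of upper triangular matrices, so $G_d/B_d$ is identified with the set of complete flags $F=(0=F_0\subseteq F_1\subseteq\dots\subseteq F_d=\mathbb{F}_q^d)$, $\dim F_i=i$. Let $\mathcal{F}(n,d)$ be the set of all $n$-step partial flags $F=(0=F_0\subseteq F_1\subseteq\dots\subseteq F_{n-1}\subseteq F_n=\mathbb{F}_q^d)$ (no condition on the dimensions). $G_d$ acts on all of these and on $\mathbb{F}_q^d$, and diagonally on products. For a finite $G_d$-set $X$, $\mathbb{C}(X)^{G_d}$ is the space of $G_d$-invariant functions $X\to\mathbb{C}$. Define $\mathcal{MU}_q(n,d)=\mathbb{C}(\mathcal{F}(n,d)\times\mathcal{F}(n,d)\times\mathbb{F}_q^d)^{G_d}$ (mirabolic quantum Schur algebra), $\mathcal{R}_d(q)=\mathbb{C}(G_d/B_d\times G_d/B_d\times\mathbb{F}_q^d)^{G_d}$ (mirabolic Hecke algebra), $\mathcal{MT}_q(n,d)=\mathbb{C}(\mathcal{F}(n,d)\times G_d/B_d\times\mathbb{F}_q^d)^{G_d}$ (mirabolic tensor space). The first two are unital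 associative algebras, and the third is a left $\mathcal{MU}_q(n,d)$-module and right $\mathcal{R}_d(q)$-module, with products and actions all given by the convolution formula $$(\alpha*\beta)(F,F',v)=\sum_{H,\,u\in\mathbb{F}_q^d}\alpha(F,H,u)\,\beta(H,F',v-u),$$ where $H$ runs over $\mathcal{F}(n,d)$ for the product of $\mathcal{MU}_q(n,d)$ and its left action on $\mathcal{MT}_q(n,d)$, and over $G_d/B_d$ for the product of $\mathcal{R}_d(q)$ and its right action on $\mathcal{MT}_q(n,d)$. $\mathrm{End}_{\mathcal{R}_d(q)}$ denotes endomorphisms of right $\mathcal{R}_d(q)$-modules. *)

theory Defs
  imports
    "HOL-Analysis.Cartesian_Space"
    "HOL-Library.FuncSet"
    "HOL-Algebra.Module"
    "HOL-Algebra.QuotRing"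
begin

text \<open>
  The finite field with \<open>q\<close> elements is an arbitrary type \<open>'k\<close> of sort \<open>{finite, field}\<close>
  (so \<open>q = CARD('k)\<close>, necessarily a prime power), and its \<open>d\<close>-dimensional coordinate space is
  \<open>'k ^ 'd\<close> with \<open>d = CARD('d)\<close>, necessarily positive.
  A flag \<open>F\<^sub>0 \<subseteq> \<dots> \<subseteq> F\<^sub>n\<close> is the list \<open>[F\<^sub>0, \<dots>, F\<^sub>n]\<close> of length \<open>n + 1\<close>.
\<close>

type_synonym ('k, 'd) flag = "('k ^ 'd) set list"

type_synonym ('k, 'd) flag_fun =
  "('k, 'd) flag \<times> ('k, 'd) flag \<times> ('k ^ 'd) \<Rightarrow> complex"

definition partial_flags :: "nat \<Rightarrow> ('k::field, 'd::finite) flag set" where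
  "partial_flags n =
    {F. length F = n + 1 \<and>
        (\<forall>i\<le>n. vec.subspace (F ! i)) \<and>
        (\<forall>i<n. F ! i \<subseteq> F ! (i + 1)) \<and>
        F ! 0 = {0} \<and> F ! n = UNIV}"

text \<open>
  The complete flags are the model of \<open>G\<^sub>d / B\<^sub>d\<close>: the coset \<open>g B\<^sub>d\<close> corresponds to the image
  under \<open>g\<close> of the standard flag, whose stabiliser is \<open>B\<^sub>d\<close>.
\<close>

definition complete_flags :: "('k::field, 'd::finite) flag set" where
  "complete_flags =
    {F \<in> partial_flags CARD('d). \<forall>i\<le>CARD('d). vec.dim (F ! i) = i}"

definition GL :: "('k::field ^ 'd::finite ^ 'd) set" where
  "GL = {g. invertible g}"

definition flag_act :: "'k::field ^ 'd::finite ^ 'd \<Rightarrow> ('k, 'd) flag \<Rightarrow> ('k, 'd) flag" where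
  "flag_act g F = map (\<lambda>U. (\<lambda>v. g *v v) ` U) F"

definition diag_act ::
  "'k::field ^ 'd::finite ^ 'd \<Rightarrow> ('k, 'd) flag \<times> ('k, 'd) flag \<times> ('k ^ 'd)
    \<Rightarrow> ('k, 'd) flag \<times> ('k, 'd) flag \<times> ('k ^ 'd)" where
  "diag_act g = (\<lambda>(F, F', v). (flag_act g F, flag_act g F', g *v v))"

text \<open>
  The space of invariant functions on \<open>X \<times> Y \<times> 'k ^ 'd\<close>. A function on this set is represented
  by its extension by zero, so that equality of functions is equality in HOL.
\<close>

definition invariant_functions ::
  "('k::field, 'd::finite) flag set \<Rightarrow> ('k, 'd) flag set \<Rightarrow> ('k, 'd) flag_fun set" where
  "invariant_functions X Y =
    {f. (\<forall>x. x \<notin> X \<times> Y \<times> UNIV \<longrightarrow> f x = 0) \<and>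
        (\<forall>g\<in>GL. \<forall>x\<in>X \<times> Y \<times> UNIV. f (diag_act g x) = f x)}"

text \<open>The index set \<open>Y\<close> is the set over which the intermediate flag \<open>H\<close> runs.\<close>

definition flag_conv ::
  "('k::field, 'd::finite) flag set \<Rightarrow> ('k, 'd) flag_fun \<Rightarrow> ('k, 'd) flag_fun
    \<Rightarrow> ('k, 'd) flag_fun" where
  "flag_conv Y \<alpha> \<beta> =
    (\<lambda>(F, F', v). \<Sum>H\<in>Y. \<Sum>u\<in>UNIV. \<alpha> (F, H, u) * \<beta> (H, F', v - u))"

text \<open>
  Unital associative complex algebras are represented by the record type of \<^theory>\<open>HOL-Algebra.Module\<close>
  (the locale \<open>algebra\<close> there is not used, as it assumes commutativity).
\<close>

definition conv_algebra ::
  "('k::field, 'd::finite) flag set \<Rightarrow> (complex, ('k, 'd) flag_fun) module" where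
  "conv_algebra X =
    \<lparr>carrier = invariant_functions X X,
     mult = flag_conv X,
     one = (\<lambda>(F, F', v). if F \<in> X \<and> F = F' \<and> v = 0 then 1 else 0),
     zero = (\<lambda>x. 0),
     add = (\<lambda>\<alpha> \<beta> x. \<alpha> x + \<beta> x),
     smult = (\<lambda>c \<alpha> x. c * \<alpha> x)\<rparr>"

definition mirabolic_Schur :: "nat \<Rightarrow> (complex, ('k::field, 'd::finite) flag_fun) module" where
  "mirabolic_Schur n = conv_algebra (partial_flags n)"

definition mirabolic_Hecke :: "(complex, ('k::field, 'd::finite) flag_fun) module" where
  "mirabolic_Hecke = conv_algebra complete_flags"

text \<open>As usual for modules in this record type, the fields \<open>mult\<close> and \<open>one\<close> carry no meaning.\<close>

definition mirabolic_tensor :: "nat \<Rightarrow> (complex, ('k::field, 'd::finite) flag_fun) module" where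
  "mirabolic_tensor n =
    \<lparr>carrier = invariant_functions (partial_flags n) complete_flags,
     mult = undefined,
     one = undefined,
     zero = (\<lambda>x. 0),
     add = (\<lambda>\<alpha> \<beta> x. \<alpha> x + \<beta> x),
     smult = (\<lambda>c \<alpha> x. c * \<alpha> x)\<rparr>"

text \<open>
  The algebra of linear endomorphisms of \<open>M\<close> commuting with the right action
  \<open>act :: 'm \<Rightarrow> 'r \<Rightarrow> 'm\<close> of \<open>R\<close>, under composition. The endomorphisms are extensional functions on
  the carrier, so that they are equal as soon as they agree on \<open>M\<close>.
\<close>

definition right_module_End ::
  "(complex, 'r) module \<Rightarrow> (complex, 'm) module \<Rightarrow> ('m \<Rightarrow> 'r \<Rightarrow> 'm)
    \<Rightarrow> (complex, 'm \<Rightarrow> 'm) module" where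
  "right_module_End R M act =
    \<lparr>carrier =
       {\<phi> \<in> carrier M \<rightarrow>\<^sub>E carrier M.
          (\<forall>x\<in>carrier M. \<forall>y\<in>carrier M. \<phi> (x \<oplus>\<^bsub>M\<^esub> y) = \<phi> x \<oplus>\<^bsub>M\<^esub> \<phi> y) \<and>
          (\<forall>c. \<forall>x\<in>carrier M. \<phi> (c \<odot>\<^bsub>M\<^esub> x) = c \<odot>\<^bsub>M\<^esub> \<phi> x) \<and>
          (\<forall>x\<in>carrier M. \<forall>r\<in>carrier R. \<phi> (act x r) = act (\<phi> x) r)},
     mult = (\<lambda>\<phi> \<psi>. \<lambda>x\<in>carrier M. \<phi> (\<psi> x)),
     one = (\<lambda>x\<in>carrier M. x),
     zero = (\<lambda>x\<in>carrier M. \<zero>\<^bsub>M\<^esub>),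
     add = (\<lambda>\<phi> \<psi>. \<lambda>x\<in>carrier M. \<phi> x \<oplus>\<^bsub>M\<^esub> \<psi> x),
     smult = (\<lambda>c \<phi>. \<lambda>x\<in>carrier M. c \<odot>\<^bsub>M\<^esub> \<phi> x)\<rparr>"

definition algebra_iso :: "(complex, 'a) module \<Rightarrow> (complex, 'b) module \<Rightarrow> ('a \<Rightarrow> 'b) set" where
  "algebra_iso A B =
    {h \<in> ring_iso A B. \<forall>c. \<forall>x\<in>carrier A. h (c \<odot>\<^bsub>A\<^esub> x) = c \<odot>\<^bsub>B\<^esub> h x}"

end

theory Submission
  imports Defs
begin

text \<open>
  Write \<open>V\<close> for \<open>'k ^ 'd\<close>. The \<open>GL\<close>-stable sets of flags are the objects of a linear category
  in which the morphisms between \<open>X\<close> and \<open>Y\<close> are the invariant functions on \<open>X \<times> Y \<times> V\<close> and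
  composition is convolution. The Schur algebra and the Hecke algebra are the endomorphism
  algebras of the objects \<open>\<F>\<close> (partial flags) and \<open>\<B>\<close> (complete flags), and the tensor space is
  the space of morphisms between them. The theorem is an instance of a general fact: if \<open>\<F>\<close> is a
  finite direct sum of direct summands of \<open>\<B>\<close>, then every endomorphism of the right module of
  morphisms is composition with a unique endomorphism of \<open>\<F>\<close>.

  The summands of \<open>\<F>\<close> are indexed by the types \<open>\<tau>\<close>, the lists of dimensions of a flag. The
  morphisms \<open>to_complete n \<tau>\<close> and \<open>from_complete n \<tau>\<close>, written \<open>p\<^sub>\<tau>\<close> and \<open>i\<^sub>\<tau>\<close> here, are supported
  at \<open>v = 0\<close>, on the pairs of a flag of type \<open>\<tau>\<close> and a complete flag that refines it. A complete
  flag has only one term of each dimension, so it refines at most one flag of type \<open>\<tau>\<close>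
  (\<open>flag_eq_of_common_completion\<close>); and every partial flag has a complete refinement
  (\<open>exists_completion\<close>), so \<open>p\<^sub>\<tau>\<close> may be divided by the number of refinements. Hence
  \<open>p\<^sub>\<tau> * i\<^sub>\<tau>\<close> is the unit restricted to flags of type \<open>\<tau>\<close>, and \<open>\<Sum>\<^sub>\<tau> p\<^sub>\<tau> * i\<^sub>\<tau> = 1\<close>
  (\<open>conv_unit_split\<close>).

  For an endomorphism \<open>\<phi>\<close> of the tensor space put \<open>\<alpha> = \<Sum>\<^sub>\<tau> \<phi> p\<^sub>\<tau> * i\<^sub>\<tau>\<close>. As \<open>i\<^sub>\<tau> * m\<close> lies in the Hecke
  algebra for every \<open>m\<close> in the tensor space,
  \<open>\<phi> m = \<phi> (\<Sum>\<^sub>\<tau> p\<^sub>\<tau> * (i\<^sub>\<tau> * m)) = \<Sum>\<^sub>\<tau> \<phi> p\<^sub>\<tau> * (i\<^sub>\<tau> * m) = \<alpha> * m\<close>.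
  Conversely, if \<open>\<phi>\<close> is left multiplication by \<open>\<beta>\<close>, then
  \<open>\<alpha> = \<Sum>\<^sub>\<tau> (\<beta> * p\<^sub>\<tau>) * i\<^sub>\<tau> = \<beta> * 1 = \<beta>\<close>. So \<open>\<phi> \<mapsto> \<alpha>\<close> is a bijection inverse to the left action, and
  it is multiplicative because the left action is.
\<close>

section \<open>Convolution of invariant functions\<close>

definition stable_flags :: "('k::field, 'd::finite) flag set \<Rightarrow> bool" where
  "stable_flags X \<longleftrightarrow> (\<forall>g\<in>GL. \<forall>F\<in>X. flag_act g F \<in> X)"

definition conv_unit :: "('k::field, 'd::finite) flag set \<Rightarrow> ('k, 'd) flag_fun" where
  "conv_unit X = (\<lambda>(F, F', v). if F \<in> X \<and> F = F' \<and> v = 0 then 1 else 0)"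

lemma flag_conv_assoc:
  fixes \<alpha> \<beta> \<gamma> :: "('k::{finite,field}, 'd::finite) flag_fun"
  shows "flag_conv Z (flag_conv Y \<alpha> \<beta>) \<gamma> = flag_conv Y \<alpha> (flag_conv Z \<beta> \<gamma>)"
proof (rule ext, clarify)
  fix F F' :: "('k, 'd) flag" and v :: "'k ^ 'd"
  \<comment> \<open>The two bracketings differ by the translation \<open>w \<mapsto> w + u\<close> of the inner vector variable.\<close>
  have shift: "(\<Sum>w\<in>UNIV. \<beta> (H, K, w - u) * \<gamma> (K, F', v - w))
      = (\<Sum>w\<in>UNIV. \<beta> (H, K, w) * \<gamma> (K, F', v - u - w))" for H K u
    by (rule sum.reindex_bij_witness[where i = "\<lambda>w. w + u" and j = "\<lambda>w. w - u"])
       (auto simp: algebra_simps)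
  have "flag_conv Z (flag_conv Y \<alpha> \<beta>) \<gamma> (F, F', v)
      = (\<Sum>K\<in>Z. \<Sum>w\<in>UNIV. \<Sum>H\<in>Y. \<Sum>u\<in>UNIV.
          \<alpha> (F, H, u) * (\<beta> (H, K, w - u) * \<gamma> (K, F', v - w)))"
    by (simp add: flag_conv_def sum_distrib_right mult.assoc)
  also have "\<dots> = (\<Sum>K\<in>Z. \<Sum>H\<in>Y. \<Sum>w\<in>UNIV. \<Sum>u\<in>UNIV.
          \<alpha> (F, H, u) * (\<beta> (H, K, w - u) * \<gamma> (K, F', v - w)))"
    by (rule sum.cong[OF refl], rule sum.swap)
  also have "\<dots> = (\<Sum>H\<in>Y. \<Sum>K\<in>Z. \<Sum>w\<in>UNIV. \<Sum>u\<in>UNIV.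
          \<alpha> (F, H, u) * (\<beta> (H, K, w - u) * \<gamma> (K, F', v - w)))"
    by (rule sum.swap)
  also have "\<dots> = (\<Sum>H\<in>Y. \<Sum>K\<in>Z. \<Sum>u\<in>UNIV. \<Sum>w\<in>UNIV.
          \<alpha> (F, H, u) * (\<beta> (H, K, w - u) * \<gamma> (K, F', v - w)))"
    by (rule sum.cong[OF refl], rule sum.cong[OF refl], rule sum.swap)
  also have "\<dots> = (\<Sum>H\<in>Y. \<Sum>u\<in>UNIV. \<Sum>K\<in>Z. \<Sum>w\<in>UNIV.
          \<alpha> (F, H, u) * (\<beta> (H, K, w - u) * \<gamma> (K, F', v - w)))"
    by (rule sum.cong[OF refl], rule sum.swap)
  also have "\<dots> = (\<Sum>H\<in>Y. \<Sum>u\<in>UNIV. \<Sum>K\<in>Z. \<Sum>w\<in>UNIV.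
          \<alpha> (F, H, u) * (\<beta> (H, K, w) * \<gamma> (K, F', v - u - w)))"
    by (simp only: sum_distrib_left[symmetric] shift)
  also have "\<dots> = flag_conv Y \<alpha> (flag_conv Z \<beta> \<gamma>) (F, F', v)"
    by (simp add: flag_conv_def sum_distrib_left)
  finally show "flag_conv Z (flag_conv Y \<alpha> \<beta>) \<gamma> (F, F', v)
      = flag_conv Y \<alpha> (flag_conv Z \<beta> \<gamma>) (F, F', v)" .
qed

lemma flag_conv_add_left:
  "flag_conv Y (\<lambda>x. \<alpha> x + \<alpha>' x) \<beta> = (\<lambda>x. flag_conv Y \<alpha> \<beta> x + flag_conv Y \<alpha>' \<beta> x)"
  by (auto simp: flag_conv_def fun_eq_iff algebra_simps sum.distrib)

lemma flag_conv_add_right: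
  "flag_conv Y \<alpha> (\<lambda>x. \<beta> x + \<beta>' x) = (\<lambda>x. flag_conv Y \<alpha> \<beta> x + flag_conv Y \<alpha> \<beta>' x)"
  by (auto simp: flag_conv_def fun_eq_iff algebra_simps sum.distrib)

lemma flag_conv_scale_left:
  "flag_conv Y (\<lambda>x. c * \<alpha> x) \<beta> = (\<lambda>x. c * flag_conv Y \<alpha> \<beta> x)"
  by (auto simp: flag_conv_def fun_eq_iff algebra_simps sum_distrib_left)

lemma flag_conv_scale_right:
  "flag_conv Y \<alpha> (\<lambda>x. c * \<beta> x) = (\<lambda>x. c * flag_conv Y \<alpha> \<beta> x)"
  by (auto simp: flag_conv_def fun_eq_iff algebra_simps sum_distrib_left)

lemma flag_conv_sum_left:
  fixes \<alpha> :: "'i \<Rightarrow> ('k::{finite,field}, 'd::finite) flag_fun"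
  assumes "finite I"
  shows "flag_conv Y (\<lambda>x. \<Sum>i\<in>I. \<alpha> i x) \<beta> = (\<lambda>x. \<Sum>i\<in>I. flag_conv Y (\<alpha> i) \<beta> x)"
  using assms
proof induction
  case empty
  show ?case by (auto simp: flag_conv_def fun_eq_iff)
next
  case (insert i I)
  then show ?case by (simp add: flag_conv_add_left)
qed

lemma flag_conv_sum_right:
  fixes \<beta> :: "'i \<Rightarrow> ('k::{finite,field}, 'd::finite) flag_fun"
  assumes "finite I"
  shows "flag_conv Y \<alpha> (\<lambda>x. \<Sum>i\<in>I. \<beta> i x) = (\<lambda>x. \<Sum>i\<in>I. flag_conv Y \<alpha> (\<beta> i) x)"
  using assms
proof induction
  case empty
  show ?case by (auto simp: flag_conv_def fun_eq_iff)
next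
  case (insert i I)
  then show ?case by (simp add: flag_conv_add_right)
qed

lemma invariant_functionsI:
  assumes "\<And>F F' v. F \<notin> X \<or> F' \<notin> Y \<Longrightarrow> f (F, F', v) = 0"
    and "\<And>g F F' v. g \<in> GL \<Longrightarrow> F \<in> X \<Longrightarrow> F' \<in> Y \<Longrightarrow>
      f (flag_act g F, flag_act g F', g *v v) = f (F, F', v)"
  shows "f \<in> invariant_functions X Y"
  using assms by (auto simp: invariant_functions_def diag_act_def)

lemma invariant_functions_zero:
  assumes "f \<in> invariant_functions X Y" "F \<notin> X \<or> F' \<notin> Y"
  shows "f (F, F', v) = 0"
  using assms by (auto simp: invariant_functions_def)

lemma invariant_functions_act:
  assumes "f \<in> invariant_functions X Y" "g \<in> GL" "F \<in> X" "F' \<in> Y"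
  shows "f (flag_act g F, flag_act g F', g *v v) = f (F, F', v)"
  using assms by (auto simp: invariant_functions_def diag_act_def)

lemma invariant_functions_add:
  assumes "f \<in> invariant_functions X Y" "f' \<in> invariant_functions X Y"
  shows "(\<lambda>x. f x + f' x) \<in> invariant_functions X Y"
  using assms by (simp add: invariant_functions_def)

lemma invariant_functions_scale:
  assumes "f \<in> invariant_functions X Y"
  shows "(\<lambda>x. c * f x) \<in> invariant_functions X Y"
  using assms by (simp add: invariant_functions_def)

lemma invariant_functions_sum:
  assumes "\<And>i. i \<in> I \<Longrightarrow> f i \<in> invariant_functions X Y"
  shows "(\<lambda>x. \<Sum>i\<in>I. f i x) \<in> invariant_functions X Y"
  using assms by (simp add: invariant_functions_def)

lemma conv_unit_left:
  fixes f :: "('k::{finite,field}, 'd::finite) flag_fun"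
  assumes "finite X" "f \<in> invariant_functions X Y"
  shows "flag_conv X (conv_unit X) f = f"
proof (rule ext, clarify)
  fix F F' :: "('k, 'd) flag" and v :: "'k ^ 'd"
  have "flag_conv X (conv_unit X) f (F, F', v)
      = (\<Sum>H\<in>X. \<Sum>u\<in>(UNIV :: ('k ^ 'd) set). if u = 0 then
          (if H = F then f (F, F', v) else 0) else 0)"
    unfolding flag_conv_def prod.case
    by (rule sum.cong[OF refl], rule sum.cong[OF refl]) (auto simp: conv_unit_def)
  also have "\<dots> = f (F, F', v)"
    using assms by (auto simp: invariant_functions_zero)
  finally show "flag_conv X (conv_unit X) f (F, F', v) = f (F, F', v)" .
qed

lemma conv_unit_right:
  fixes f :: "('k::{finite,field}, 'd::finite) flag_fun"
  assumes "finite Y" "f \<in> invariant_functions X Y"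
  shows "flag_conv Y f (conv_unit Y) = f"
proof (rule ext, clarify)
  fix F F' :: "('k, 'd) flag" and v :: "'k ^ 'd"
  have "flag_conv Y f (conv_unit Y) (F, F', v)
      = (\<Sum>H\<in>Y. \<Sum>u\<in>UNIV. if u = v then (if H = F' then f (F, F', v) else 0) else 0)"
    unfolding flag_conv_def prod.case
    by (rule sum.cong[OF refl], rule sum.cong[OF refl]) (auto simp: conv_unit_def)
  also have "\<dots> = f (F, F', v)"
    using assms by (auto simp: invariant_functions_zero)
  finally show "flag_conv Y f (conv_unit Y) (F, F', v) = f (F, F', v)" .
qed

lemma GL_inverse:
  fixes g :: "'k::field ^ 'd::finite ^ 'd"
  assumes "g \<in> GL"
  obtains h where "h \<in> GL" "\<And>v. h *v (g *v v) = v" "\<And>v. g *v (h *v v) = v"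
proof -
  from assms obtain h where h: "g ** h = mat 1" "h ** g = mat 1"
    by (auto simp: GL_def invertible_def)
  then have "h \<in> GL" by (auto simp: GL_def invertible_def)
  with h that show thesis
    by (simp add: matrix_vector_mul_assoc)
qed

lemma flag_act_cancel:
  assumes "\<And>v. h *v (g *v v) = v"
  shows "flag_act h (flag_act g F) = F"
  using assms by (simp add: flag_act_def o_def image_image)

lemma flag_conv_invariant:
  fixes \<alpha> \<beta> :: "('k::{finite,field}, 'd::finite) flag_fun"
  assumes Y: "stable_flags Y"
    and \<alpha>: "\<alpha> \<in> invariant_functions X Y" and \<beta>: "\<beta> \<in> invariant_functions Y Z"
  shows "flag_conv Y \<alpha> \<beta> \<in> invariant_functions X Z"
proof (rule invariant_functionsI)
  fix F F' :: "('k, 'd) flag" and v :: "'k ^ 'd"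
  assume "F \<notin> X \<or> F' \<notin> Z"
  then have zero: "\<alpha> (F, H, u) * \<beta> (H, F', w) = 0" for H u w
    using \<alpha> \<beta> by (auto simp: invariant_functions_zero)
  show "flag_conv Y \<alpha> \<beta> (F, F', v) = 0"
    by (simp only: flag_conv_def prod.case zero sum.neutral_const)
next
  fix g :: "'k ^ 'd ^ 'd" and F F' :: "('k, 'd) flag" and v :: "'k ^ 'd"
  assume g: "g \<in> GL" and F: "F \<in> X" "F' \<in> Z"
  obtain h where h: "h \<in> GL" "\<And>v. h *v (g *v v) = v" "\<And>v. g *v (h *v v) = v"
    using g by (rule GL_inverse) blast
  \<comment> \<open>Substitute \<open>g H\<close> for the intermediate flag and \<open>g u\<close> for the intermediate vector; stability
    of \<open>Y\<close> makes the first substitution a permutation of \<open>Y\<close>.\<close>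
  have "(\<Sum>H\<in>Y. \<Sum>u\<in>UNIV. \<alpha> (F, H, u) * \<beta> (H, F', v - u))
      = (\<Sum>H\<in>Y. \<Sum>u\<in>UNIV. \<alpha> (flag_act g F, H, u) * \<beta> (H, flag_act g F', g *v v - u))"
  proof (rule sum.reindex_bij_witness[where i = "flag_act h" and j = "flag_act g"])
    fix H assume H: "H \<in> Y"
    show "(\<Sum>u\<in>UNIV. \<alpha> (flag_act g F, flag_act g H, u)
          * \<beta> (flag_act g H, flag_act g F', g *v v - u))
        = (\<Sum>u\<in>UNIV. \<alpha> (F, H, u) * \<beta> (H, F', v - u))"
    proof (rule sum.reindex_bij_witness[where i = "(*v) g" and j = "(*v) h"])
      fix u
      have "\<alpha> (F, H, h *v u) = \<alpha> (flag_act g F, flag_act g H, g *v (h *v u))"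
        using invariant_functions_act[OF \<alpha> g F(1) H] by simp
      moreover have "\<beta> (H, F', v - h *v u)
          = \<beta> (flag_act g H, flag_act g F', g *v (v - h *v u))"
        using invariant_functions_act[OF \<beta> g H F(2)] by simp
      ultimately show "\<alpha> (F, H, h *v u) * \<beta> (H, F', v - h *v u)
          = \<alpha> (flag_act g F, flag_act g H, u) * \<beta> (flag_act g H, flag_act g F', g *v v - u)"
        by (simp add: h matrix_vector_mult_diff_distrib)
    qed (auto simp: h)
  qed (use Y g h in \<open>auto simp: flag_act_cancel stable_flags_def\<close>)
  then show "flag_conv Y \<alpha> \<beta> (flag_act g F, flag_act g F', g *v v) = flag_conv Y \<alpha> \<beta> (F, F', v)"
    by (simp add: flag_conv_def)
qed

section \<open>Partial and complete flags\<close>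

lemma finite_partial_flags: "finite (partial_flags n :: ('k::{finite,field}, 'd::finite) flag set)"
proof (rule finite_subset)
  show "(partial_flags n :: ('k, 'd) flag set) \<subseteq> {F. set F \<subseteq> UNIV \<and> length F = n + 1}"
    by (auto simp: partial_flags_def)
qed (rule finite_lists_length_eq, simp)

lemma finite_complete_flags: "finite (complete_flags :: ('k::{finite,field}, 'd::finite) flag set)"
  by (rule finite_subset[OF _ finite_partial_flags]) (auto simp: complete_flags_def)

lemma dim_GL_image:
  assumes "g \<in> GL"
  shows "vec.dim ((*v) g ` U) = vec.dim U"
proof -
  obtain h where "\<And>v. h *v (g *v v) = v"
    using assms by (rule GL_inverse) blast
  then have "inj ((*v) g)" by (metis injI)
  then show ?thesis
    by (intro vec.dim_image_eq matrix_vector_mul_linear_gen) (auto intro: inj_on_subset)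
qed

lemma stable_partial_flags: "stable_flags (partial_flags n :: ('k::field, 'd::finite) flag set)"
  unfolding stable_flags_def
proof (intro ballI)
  fix g :: "'k ^ 'd ^ 'd" and F :: "('k, 'd) flag"
  assume g: "g \<in> GL" and F: "F \<in> partial_flags n"
  obtain h where h: "\<And>v. g *v (h *v v) = v"
    using g by (rule GL_inverse) blast
  then have "surj ((*v) g)" by (metis surjI)
  moreover have "vec.subspace ((*v) g ` U)" if "vec.subspace U" for U
    using that by (intro vec.subspace_image matrix_vector_mul_linear_gen)
  ultimately show "flag_act g F \<in> partial_flags n"
    using F by (simp add: partial_flags_def flag_act_def image_mono)
qed

lemma stable_complete_flags: "stable_flags (complete_flags :: ('k::field, 'd::finite) flag set)"
  unfolding stable_flags_def
proof (intro ballI)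
  fix g :: "'k ^ 'd ^ 'd" and F :: "('k, 'd) flag"
  assume g: "g \<in> GL" and F: "F \<in> complete_flags"
  then have "flag_act g F \<in> partial_flags CARD('d)"
    using stable_partial_flags by (auto simp: stable_flags_def complete_flags_def)
  moreover have "vec.dim (flag_act g F ! i) = i" if "i \<le> CARD('d)" for i
  proof -
    have "flag_act g F ! i = (*v) g ` (F ! i)"
      using F that by (simp add: flag_act_def complete_flags_def partial_flags_def)
    then show ?thesis using F g that by (simp add: dim_GL_image complete_flags_def)
  qed
  ultimately show "flag_act g F \<in> complete_flags" by (simp add: complete_flags_def)
qed

definition flag_type :: "('k::field, 'd::finite) flag \<Rightarrow> nat list" where
  "flag_type F = map vec.dim F"

lemma flag_type_act: "g \<in> GL \<Longrightarrow> flag_type (flag_act g F) = flag_type F"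
  by (simp add: flag_type_def flag_act_def dim_GL_image)

lemma set_flag_act_subset:
  assumes "g \<in> GL"
  shows "set (flag_act g F) \<subseteq> set (flag_act g C) \<longleftrightarrow> set F \<subseteq> set C"
proof -
  obtain h where "\<And>v. h *v (g *v v) = v"
    using assms by (rule GL_inverse) blast
  then have "inj ((*v) g)" by (metis injI)
  then have "inj ((`) ((*v) g))" by (simp add: inj_image_eq_iff inj_def)
  then show ?thesis
    by (simp add: flag_act_def inj_image_subset_iff)
qed

text \<open>
  The terms of a complete flag have pairwise distinct dimensions, so a term of \<open>F\<close> is determined
  by \<open>C\<close> and its dimension. Refinement is expressed by inclusion of the sets of terms.
\<close>

lemma flag_eq_of_common_completion:
  assumes "C \<in> complete_flags" "set F \<subseteq> set C" "set F' \<subseteq> set C" "flag_type F = flag_type F'"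
  shows "F = F'"
proof (rule nth_equalityI)
  show len: "length F = length F'"
    using assms(4) by (metis flag_type_def length_map)
  fix i assume i: "i < length F"
  then have "F ! i \<in> set C" "F' ! i \<in> set C"
    using assms len by auto
  then obtain j j' where j: "j < length C" "F ! i = C ! j" "j' < length C" "F' ! i = C ! j'"
    by (metis in_set_conv_nth)
  have "vec.dim (F ! i) = vec.dim (F' ! i)"
    using assms(4) i len by (metis flag_type_def nth_map)
  then have "j = j'"
    using j assms(1) by (auto simp: complete_flags_def partial_flags_def)
  then show "F ! i = F' ! i" using j by simp
qed

lemma chain_dim_le:
  assumes "vec.subspace U" "vec.subspace W" "U \<subseteq> W \<or> W \<subseteq> U" "vec.dim U \<le> vec.dim W"
  shows "U \<subseteq> W"
  using assms vec.subspace_dim_equal by blast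

text \<open>
  The terms of \<open>F\<close> form a chain of subspaces; extend it to a maximal chain \<open>S\<close>. If \<open>U \<in> S\<close> is not the
  whole space and \<open>W\<close> is the next larger member of \<open>S\<close>, then adding to \<open>U\<close> one vector of \<open>W\<close>
  gives a subspace comparable with all of \<open>S\<close>, which lies in \<open>S\<close> by maximality. So every
  dimension occurs in \<open>S\<close>, and the members of \<open>S\<close> in order of dimension form a complete flag.
\<close>

lemma exists_completion:
  fixes F :: "('k::{finite,field}, 'd::finite) flag"
  assumes F: "F \<in> partial_flags n"
  shows "\<exists>C\<in>complete_flags. set F \<subseteq> set C"
proof -
  define chains where "chains = {S :: ('k ^ 'd) set set.
    (\<forall>U\<in>S. vec.subspace U) \<and> (\<forall>U\<in>S. \<forall>W\<in>S. U \<subseteq> W \<or> W \<subseteq> U)}"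
  have mono: "F ! i \<subseteq> F ! j" if "i \<le> j" "j \<le> n" for i j
    using that
  proof (induction rule: dec_induct)
    case base
    show ?case by simp
  next
    case (step m)
    moreover have "F ! m \<subseteq> F ! Suc m"
      using F step by (simp add: partial_flags_def)
    ultimately show ?case by auto
  qed
  have terms: "\<exists>i\<le>n. U = F ! i" if "U \<in> set F" for U
    using that F by (auto simp: partial_flags_def in_set_conv_nth less_Suc_eq_le)
  have "set F \<in> chains"
  proof -
    have "vec.subspace U" if "U \<in> set F" for U
      using terms[OF that] F by (auto simp: partial_flags_def)
    moreover have "U \<subseteq> W \<or> W \<subseteq> U" if U: "U \<in> set F" and W: "W \<in> set F" for U W
    proof -
      obtain i where i: "i \<le> n" "U = F ! i" using terms[OF U] by blast
      obtain j where j: "j \<le> n" "W = F ! j" using terms[OF W] by blast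
      show ?thesis using mono[of i j] mono[of j i] i j by (cases "i \<le> j") auto
    qed
    ultimately show ?thesis by (simp add: chains_def)
  qed
  then obtain S where S: "S \<in> chains" "set F \<subseteq> S"
    and max: "\<And>S'. S' \<in> chains \<Longrightarrow> S \<subseteq> S' \<Longrightarrow> S = S'"
    using finite_has_maximal2[of chains "set F"] by auto
  have sub: "vec.subspace U" if "U \<in> S" for U
    using S that by (auto simp: chains_def)
  have chain: "U \<subseteq> W \<or> W \<subseteq> U" if "U \<in> S" "W \<in> S" for U W
    using S that by (auto simp: chains_def)
  have le: "U \<subseteq> W" if "U \<in> S" "W \<in> S" "vec.dim U \<le> vec.dim W" for U W
    using that by (intro chain_dim_le sub chain)
  have "F ! 0 \<in> set F" "F ! n \<in> set F"
    using F nth_mem[of 0 F] nth_mem[of n F] by (simp_all add: partial_flags_def)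
  moreover have "F ! 0 = {0}" "F ! n = UNIV" using F by (simp_all add: partial_flags_def)
  ultimately have ends: "{0} \<in> S" "UNIV \<in> S" using S by auto
  have step: "\<exists>W\<in>S. vec.dim W = Suc (vec.dim U)" if U: "U \<in> S" "vec.dim U < CARD('d)" for U
  proof -
    define T where "T = {W \<in> S. vec.dim U < vec.dim W}"
    have "UNIV \<in> T" using U ends by (simp add: T_def card_cart_basis)
    then obtain W where W: "W \<in> T" "\<And>W'. W' \<in> T \<Longrightarrow> vec.dim W \<le> vec.dim W'"
      using ex_has_least_nat[of "\<lambda>W. W \<in> T" UNIV vec.dim] by blast
    have WS: "W \<in> S" "vec.dim U < vec.dim W" using W by (auto simp: T_def)
    then have "U \<subseteq> W" "U \<noteq> W" using le[of U W] U(1) by auto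
    then obtain x where x: "x \<in> W" "x \<notin> U" by blast
    define V where "V = vec.span (insert x U)"
    have "x \<notin> vec.span U" using x sub[OF U(1)] by (metis vec.span_eq_iff)
    then have dimV: "vec.dim V = Suc (vec.dim U)" by (simp add: V_def vec.dim_insert)
    have "U \<subseteq> V" using vec.span_superset[of "insert x U"] by (auto simp: V_def)
    have "V \<subseteq> W" unfolding V_def using x \<open>U \<subseteq> W\<close> sub[OF WS(1)] by (intro vec.span_minimal) auto
    have "X \<subseteq> V \<or> V \<subseteq> X" if "X \<in> S" for X
    proof (cases "vec.dim X \<le> vec.dim U")
      case True
      then show ?thesis using le[OF that U(1)] \<open>U \<subseteq> V\<close> by auto
    next
      case False
      then have "vec.dim W \<le> vec.dim X" using W(2)[of X] that by (simp add: T_def)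
      then show ?thesis using le[OF WS(1) that] \<open>V \<subseteq> W\<close> by auto
    qed
    then have "insert V S \<in> chains"
      using sub chain by (auto simp: chains_def V_def)
    then have "V \<in> S" using max by blast
    with dimV show ?thesis by blast
  qed
  have all: "\<exists>U\<in>S. vec.dim U = j" if "j \<le> CARD('d)" for j
    using that
  proof (induction j)
    case 0
    have "vec.dim ({0} :: ('k ^ 'd) set) = 0" by simp
    then show ?case using ends(1) by blast
  next
    case (Suc j)
    then obtain U where "U \<in> S" "vec.dim U = j" by auto
    then show ?case using step[of U] Suc.prems by auto
  qed
  then obtain c where c: "\<And>j. j \<le> CARD('d) \<Longrightarrow> c j \<in> S \<and> vec.dim (c j) = j"
    by metis
  define C where "C = map c [0..<CARD('d) + 1]"
  have nthC: "C ! j = c j" if "j \<le> CARD('d)" for j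
    using that unfolding C_def by (subst nth_map) (auto simp del: upt_Suc)
  have c_eq: "c (vec.dim U) = U" if "U \<in> S" for U
  proof -
    have "c (vec.dim U) \<in> S" "vec.dim (c (vec.dim U)) = vec.dim U"
      using c[OF dim_subset_UNIV_cart_gen[of U]] by auto
    then show ?thesis using le[of "c (vec.dim U)" U] le[of U "c (vec.dim U)"] that by auto
  qed
  have "C \<in> complete_flags"
  proof -
    have "c 0 = {0}" using c_eq[OF ends(1)] by simp
    moreover have "c CARD('d) = UNIV"
      using c_eq[OF ends(2)] by (simp add: card_cart_basis)
    moreover have "c i \<subseteq> c (Suc i)" if "i < CARD('d)" for i
      using c[of i] c[of "Suc i"] that by (intro le) auto
    ultimately show ?thesis
      using c sub by (simp add: complete_flags_def partial_flags_def nthC) (simp add: C_def)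
  qed
  moreover have "set F \<subseteq> set C"
  proof
    fix U assume "U \<in> set F"
    then have "U = c (vec.dim U)" using S c_eq by auto
    moreover have "c (vec.dim U) \<in> set C"
      using dim_subset_UNIV_cart_gen[of U] by (simp add: C_def less_Suc_eq_le del: upt_Suc)
    ultimately show "U \<in> set C" by simp
  qed
  ultimately show ?thesis by blast
qed

section \<open>Splitting the unit through the complete flags\<close>

definition completions :: "('k::field, 'd::finite) flag \<Rightarrow> ('k, 'd) flag set" where
  "completions F = {C \<in> complete_flags. set F \<subseteq> set C}"

text \<open>
  The division by the number of completions makes \<open>to_complete n \<tau> * from_complete n \<tau>\<close>
  idempotent; it keeps the function invariant because that number is constant on orbits.
\<close>

definition to_complete :: "nat \<Rightarrow> nat list \<Rightarrow> ('k::field, 'd::finite) flag_fun" where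
  "to_complete n \<tau> = (\<lambda>(F, C, v).
     if F \<in> partial_flags n \<and> flag_type F = \<tau> \<and> C \<in> completions F \<and> v = 0
     then 1 / of_nat (card (completions F)) else 0)"

definition from_complete :: "nat \<Rightarrow> nat list \<Rightarrow> ('k::field, 'd::finite) flag_fun" where
  "from_complete n \<tau> = (\<lambda>(C, F, v).
     if F \<in> partial_flags n \<and> flag_type F = \<tau> \<and> C \<in> completions F \<and> v = 0 then 1 else 0)"

text \<open>
  The type argument fixes the field and the dimension, which lists of natural numbers do not show.
\<close>

definition flag_types :: "('k::field, 'd::finite) flag itself \<Rightarrow> nat \<Rightarrow> nat list set" where
  "flag_types _ n = flag_type ` (partial_flags n :: ('k, 'd) flag set)"

lemma completions_act_iff:
  assumes "g \<in> GL"
  shows "flag_act g C \<in> completions (flag_act g F) \<longleftrightarrow> C \<in> completions F"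
proof -
  obtain h where h: "h \<in> GL" "\<And>v. h *v (g *v v) = v"
    using assms by (rule GL_inverse) blast
  have "flag_act g C \<in> complete_flags \<longleftrightarrow> C \<in> complete_flags"
    using stable_complete_flags assms h flag_act_cancel[OF h(2)]
    unfolding stable_flags_def by metis
  then show ?thesis
    by (simp add: completions_def set_flag_act_subset assms)
qed

lemma card_completions_act:
  assumes "g \<in> GL"
  shows "card (completions (flag_act g F)) = card (completions F)"
proof -
  obtain h where h: "h \<in> GL" "\<And>v. h *v (g *v v) = v" "\<And>v. g *v (h *v v) = v"
    using assms by (rule GL_inverse) blast
  have "bij_betw (flag_act g) (completions F) (completions (flag_act g F))"
  proof (rule bij_betw_byWitness[where f' = "flag_act h"])
    show "flag_act h ` completions (flag_act g F) \<subseteq> completions F"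
      using completions_act_iff[OF h(1), of _ "flag_act g F"] by (auto simp: flag_act_cancel h)
  qed (auto simp: completions_act_iff assms flag_act_cancel h)
  then show ?thesis by (simp add: bij_betw_same_card)
qed

lemma GL_mult_eq_0_iff: "g \<in> GL \<Longrightarrow> g *v v = 0 \<longleftrightarrow> v = 0"
  by (metis GL_inverse matrix_vector_mult_0_right)

lemma partial_flags_act_iff:
  assumes "g \<in> GL" "F \<in> partial_flags n"
  shows "flag_act g F \<in> partial_flags n"
  using assms stable_partial_flags by (auto simp: stable_flags_def)

lemma to_complete_invariant:
  "to_complete n \<tau> \<in> invariant_functions (partial_flags n) complete_flags"
  by (rule invariant_functionsI)
     (auto simp: to_complete_def completions_act_iff card_completions_act flag_type_act
       GL_mult_eq_0_iff partial_flags_act_iff, auto simp: completions_def)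

lemma from_complete_invariant:
  "from_complete n \<tau> \<in> invariant_functions complete_flags (partial_flags n)"
  by (rule invariant_functionsI)
     (auto simp: from_complete_def completions_act_iff flag_type_act
       GL_mult_eq_0_iff partial_flags_act_iff, auto simp: completions_def)

text \<open>
  An intermediate complete flag contributes only if it refines both \<open>F\<close> and \<open>F'\<close>, which have the
  same type, so the value vanishes unless \<open>F = F'\<close>; then each of the completions of \<open>F\<close>
  contributes the inverse of their number.
\<close>

lemma to_complete_conv_from_complete:
  fixes F F' :: "('k::{finite,field}, 'd::finite) flag"
  shows "flag_conv complete_flags (to_complete n \<tau>) (from_complete n \<tau>) (F, F', v)
    = (if F \<in> partial_flags n \<and> F = F' \<and> v = 0 \<and> flag_type F = \<tau> then 1 else 0)"
    (is "?conv = (if ?P then 1 else 0)")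
proof -
  have "?conv = (\<Sum>C\<in>complete_flags. \<Sum>u\<in>(UNIV :: ('k ^ 'd) set). if u = 0 then
      (if ?P \<and> C \<in> completions F then 1 / of_nat (card (completions F)) else 0) else 0)"
    unfolding flag_conv_def prod.case
    by (rule sum.cong[OF refl], rule sum.cong[OF refl])
      (auto simp: to_complete_def from_complete_def completions_def
        dest: flag_eq_of_common_completion)
  also have "\<dots> = (if ?P then \<Sum>C\<in>completions F. 1 / of_nat (card (completions F)) else 0)"
    by (auto simp: completions_def finite_complete_flags simp flip: sum.inter_filter)
  also have "\<dots> = (if ?P then 1 else 0)"
  proof -
    have "finite (completions F)" by (simp add: completions_def finite_complete_flags)
    moreover have "completions F \<noteq> {}" if ?P
      using that exists_completion[of F n] by (auto simp: completions_def)
    ultimately show ?thesis by auto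
  qed
  finally show ?thesis .
qed

lemma finite_flag_types:
  "finite (flag_types TYPE(('k::{finite,field}, 'd::finite) flag) n)"
  by (simp add: flag_types_def finite_partial_flags)

lemma conv_unit_split:
  "(\<lambda>x. \<Sum>\<tau>\<in>flag_types TYPE(('k::{finite,field}, 'd::finite) flag) n.
      flag_conv complete_flags (to_complete n \<tau>) (from_complete n \<tau>) x)
    = (conv_unit (partial_flags n) :: ('k, 'd) flag_fun)"
proof (rule ext, clarify)
  fix F F' :: "('k, 'd) flag" and v :: "'k ^ 'd"
  have "(\<Sum>\<tau>\<in>flag_types TYPE(('k, 'd) flag) n.
      flag_conv complete_flags (to_complete n \<tau>) (from_complete n \<tau>) (F, F', v))
    = (\<Sum>\<tau>\<in>flag_types TYPE(('k, 'd) flag) n. if flag_type F = \<tau> then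
        (if F \<in> partial_flags n \<and> F = F' \<and> v = 0 then 1 else 0) else 0)"
    by (intro sum.cong refl) (simp add: to_complete_conv_from_complete)
  also have "\<dots> = conv_unit (partial_flags n) (F, F', v)"
    by (auto simp: finite_partial_flags conv_unit_def flag_types_def)
  finally show "(\<Sum>\<tau>\<in>flag_types TYPE(('k, 'd) flag) n.
      flag_conv complete_flags (to_complete n \<tau>) (from_complete n \<tau>) (F, F', v))
    = conv_unit (partial_flags n) (F, F', v)" .
qed

section \<open>Endomorphisms are left multiplications\<close>

abbreviation Hecke_End ::
  "nat \<Rightarrow> (complex, ('k::{finite,field}, 'd::finite) flag_fun \<Rightarrow> ('k, 'd) flag_fun) module" where
  "Hecke_End n \<equiv>
     right_module_End mirabolic_Hecke (mirabolic_tensor n) (flag_conv complete_flags)"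

text \<open>
  The element of the Schur algebra by which an endomorphism acts. It is obtained by applying
  \<open>\<phi>\<close> to the left factors in the decomposition \<open>conv_unit_split\<close> of the unit.
\<close>

definition End_symbol ::
  "nat \<Rightarrow> (('k::{finite,field}, 'd::finite) flag_fun \<Rightarrow> ('k, 'd) flag_fun) \<Rightarrow> ('k, 'd) flag_fun"
  where
  "End_symbol n \<phi> = (\<lambda>x. \<Sum>\<tau>\<in>flag_types TYPE(('k, 'd) flag) n.
     flag_conv complete_flags (\<phi> (to_complete n \<tau>)) (from_complete n \<tau>) x)"

lemma Hecke_End_carrier_iff:
  "\<phi> \<in> carrier (Hecke_End n) \<longleftrightarrow>
     \<phi> \<in> invariant_functions (partial_flags n) complete_flags
        \<rightarrow>\<^sub>E invariant_functions (partial_flags n) complete_flags \<and>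
     (\<forall>x\<in>invariant_functions (partial_flags n) complete_flags.
       \<forall>y\<in>invariant_functions (partial_flags n) complete_flags.
         \<phi> (\<lambda>z. x z + y z) = (\<lambda>z. \<phi> x z + \<phi> y z)) \<and>
     (\<forall>c. \<forall>x\<in>invariant_functions (partial_flags n) complete_flags.
         \<phi> (\<lambda>z. c * x z) = (\<lambda>z. c * \<phi> x z)) \<and>
     (\<forall>x\<in>invariant_functions (partial_flags n) complete_flags.
       \<forall>r\<in>invariant_functions complete_flags complete_flags.
         \<phi> (flag_conv complete_flags x r) = flag_conv complete_flags (\<phi> x) r)"
  by (simp add: right_module_End_def mirabolic_Hecke_def mirabolic_tensor_def conv_algebra_def)

lemma Hecke_End_add:
  assumes "\<phi> \<in> carrier (Hecke_End n)"
    and "x \<in> invariant_functions (partial_flags n) complete_flags"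
    and "y \<in> invariant_functions (partial_flags n) complete_flags"
  shows "\<phi> (\<lambda>z. x z + y z) = (\<lambda>z. \<phi> x z + \<phi> y z)"
  using assms by (simp add: Hecke_End_carrier_iff)

lemma Hecke_End_scale:
  assumes "\<phi> \<in> carrier (Hecke_End n)"
    and "x \<in> invariant_functions (partial_flags n) complete_flags"
  shows "\<phi> (\<lambda>z. c * x z) = (\<lambda>z. c * \<phi> x z)"
  using assms by (simp add: Hecke_End_carrier_iff)

lemma Hecke_End_act:
  assumes "\<phi> \<in> carrier (Hecke_End n)"
    and "x \<in> invariant_functions (partial_flags n) complete_flags"
    and "r \<in> invariant_functions complete_flags complete_flags"
  shows "\<phi> (flag_conv complete_flags x r) = flag_conv complete_flags (\<phi> x) r"
  using assms by (simp add: Hecke_End_carrier_iff)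

lemma Hecke_End_sum:
  assumes \<phi>: "\<phi> \<in> carrier (Hecke_End n)" and "finite I"
    and f: "\<And>i. i \<in> I \<Longrightarrow> f i \<in> invariant_functions (partial_flags n) complete_flags"
  shows "\<phi> (\<lambda>z. \<Sum>i\<in>I. f i z) = (\<lambda>z. \<Sum>i\<in>I. \<phi> (f i) z)"
  using assms(2) f
proof induction
  case empty
  have "(\<lambda>z. 0) \<in> invariant_functions (partial_flags n) complete_flags"
    by (simp add: invariant_functions_def)
  from Hecke_End_scale[OF \<phi> this, of 0] show ?case by simp
next
  case (insert i I)
  have "(\<lambda>z. \<Sum>i\<in>I. f i z) \<in> invariant_functions (partial_flags n) complete_flags"
    using insert.prems by (intro invariant_functions_sum) auto
  from Hecke_End_add[OF \<phi> insert.prems this, of i] insert show ?case by simp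
qed

lemma End_symbol_invariant:
  assumes "\<phi> \<in> carrier (Hecke_End n)"
  shows "End_symbol n \<phi> \<in> invariant_functions (partial_flags n) (partial_flags n)"
  unfolding End_symbol_def
proof (rule invariant_functions_sum, rule flag_conv_invariant)
  fix \<tau>
  show "\<phi> (to_complete n \<tau>) \<in> invariant_functions (partial_flags n) complete_flags"
    using assms to_complete_invariant unfolding Hecke_End_carrier_iff by blast
qed (rule stable_complete_flags from_complete_invariant)+

text \<open>
  Write \<open>m = 1 * m\<close> and split the unit. Then \<open>m\<close> is a sum of the \<open>to_complete n \<tau>\<close> acted on from
  the right by elements of the Hecke algebra, which \<open>\<phi>\<close> commutes with.
\<close>

lemma End_symbol_conv:
  fixes m :: "('k::{finite,field}, 'd::finite) flag_fun"
  assumes \<phi>: "\<phi> \<in> carrier (Hecke_End n)"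
    and m: "m \<in> invariant_functions (partial_flags n) complete_flags"
  shows "flag_conv (partial_flags n) (End_symbol n \<phi>) m = \<phi> m"
proof -
  let ?I = "flag_types TYPE(('k, 'd) flag) n"
  let ?r = "\<lambda>\<tau>. flag_conv (partial_flags n) (from_complete n \<tau>) m"
  have r: "?r \<tau> \<in> invariant_functions complete_flags complete_flags" for \<tau>
    by (intro flag_conv_invariant[OF stable_partial_flags] from_complete_invariant m)
  have "m = flag_conv (partial_flags n) (conv_unit (partial_flags n)) m"
    by (rule conv_unit_left[OF finite_partial_flags m, symmetric])
  also have "\<dots> = (\<lambda>x. \<Sum>\<tau>\<in>?I. flag_conv complete_flags (to_complete n \<tau>) (?r \<tau>) x)"
    by (simp flip: conv_unit_split add: flag_conv_sum_left finite_flag_types flag_conv_assoc)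
  finally have "\<phi> m = \<phi> (\<lambda>x. \<Sum>\<tau>\<in>?I. flag_conv complete_flags (to_complete n \<tau>) (?r \<tau>) x)"
    by (rule arg_cong)
  also have "\<dots> = (\<lambda>x. \<Sum>\<tau>\<in>?I. \<phi> (flag_conv complete_flags (to_complete n \<tau>) (?r \<tau>)) x)"
    by (intro Hecke_End_sum[OF \<phi>] finite_flag_types
        flag_conv_invariant[OF stable_complete_flags] to_complete_invariant r)
  also have "\<dots> = (\<lambda>x. \<Sum>\<tau>\<in>?I. flag_conv complete_flags (\<phi> (to_complete n \<tau>)) (?r \<tau>) x)"
    by (simp add: Hecke_End_act[OF \<phi> to_complete_invariant r])
  also have "\<dots> = flag_conv (partial_flags n) (End_symbol n \<phi>) m"
    by (simp add: End_symbol_def flag_conv_sum_left finite_flag_types flag_conv_assoc)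
  finally show ?thesis ..
qed

text \<open>
  The left action of the Schur algebra is faithful, with \<open>End_symbol\<close> as a left inverse. As \<open>\<phi>\<close>
  is constrained only on the tensor space, the lemma also serves to compute the symbol of a sum,
  a multiple or a composite from the way it acts.
\<close>

lemma End_symbol_left_mult:
  fixes \<alpha> :: "('k::{finite,field}, 'd::finite) flag_fun"
  assumes \<alpha>: "\<alpha> \<in> invariant_functions (partial_flags n) (partial_flags n)"
    and \<phi>: "\<And>m. m \<in> invariant_functions (partial_flags n) complete_flags \<Longrightarrow>
      \<phi> m = flag_conv (partial_flags n) \<alpha> m"
  shows "End_symbol n \<phi> = \<alpha>"
proof -
  have "End_symbol n \<phi> = flag_conv (partial_flags n) \<alpha> (conv_unit (partial_flags n))"
    unfolding End_symbol_def \<phi>[OF to_complete_invariant]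
    by (simp flip: conv_unit_split add: flag_conv_sum_right finite_flag_types flag_conv_assoc)
  also have "\<dots> = \<alpha>"
    by (rule conv_unit_right[OF finite_partial_flags \<alpha>])
  finally show ?thesis .
qed

lemma left_mult_in_Hecke_End:
  fixes \<alpha> :: "('k::{finite,field}, 'd::finite) flag_fun"
  assumes \<alpha>: "\<alpha> \<in> invariant_functions (partial_flags n) (partial_flags n)"
  shows "(\<lambda>m\<in>invariant_functions (partial_flags n) complete_flags.
      flag_conv (partial_flags n) \<alpha> m) \<in> carrier (Hecke_End n)"
  unfolding Hecke_End_carrier_iff
  by (auto simp: invariant_functions_add invariant_functions_scale flag_conv_add_right
      flag_conv_scale_right flag_conv_assoc
      flag_conv_invariant[OF stable_complete_flags] flag_conv_invariant[OF stable_partial_flags \<alpha>])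

lemma bij_betw_End_symbol:
  "bij_betw (End_symbol n) (carrier (Hecke_End n))
     (invariant_functions (partial_flags n) (partial_flags n)
       :: ('k::{finite,field}, 'd::finite) flag_fun set)"
proof (rule bij_betw_byWitness[where f' = "\<lambda>\<alpha>.
    \<lambda>m\<in>invariant_functions (partial_flags n) complete_flags. flag_conv (partial_flags n) \<alpha> m"])
  show "\<forall>\<phi>\<in>carrier (Hecke_End n). (\<lambda>m\<in>invariant_functions (partial_flags n) complete_flags.
      flag_conv (partial_flags n) (End_symbol n \<phi>) m) = (\<phi> :: ('k, 'd) flag_fun \<Rightarrow> _)"
  proof
    fix \<phi> :: "('k, 'd) flag_fun \<Rightarrow> ('k, 'd) flag_fun"
    assume \<phi>: "\<phi> \<in> carrier (Hecke_End n)"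
    then have "\<phi> \<in> extensional (invariant_functions (partial_flags n) complete_flags)"
      by (auto simp: Hecke_End_carrier_iff PiE_def)
    then show "(\<lambda>m\<in>invariant_functions (partial_flags n) complete_flags.
        flag_conv (partial_flags n) (End_symbol n \<phi>) m) = \<phi>"
      by (intro extensionalityI[where A = "invariant_functions (partial_flags n) complete_flags"])
        (auto simp: End_symbol_conv[OF \<phi>])
  qed
qed (auto simp: End_symbol_invariant left_mult_in_Hecke_End intro!: End_symbol_left_mult)

lemma End_symbol_algebra_iso:
  "End_symbol n \<in> algebra_iso (Hecke_End n)
     (mirabolic_Schur n :: (complex, ('k::{finite,field}, 'd::finite) flag_fun) module)"
proof -
  let ?M = "invariant_functions (partial_flags n) complete_flags :: ('k, 'd) flag_fun set"
  let ?U = "invariant_functions (partial_flags n) (partial_flags n) :: ('k, 'd) flag_fun set"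
  have carrier: "carrier (mirabolic_Schur n) = ?U"
    by (simp add: mirabolic_Schur_def conv_algebra_def)
  have inM: "\<phi> m \<in> ?M" if "\<phi> \<in> carrier (Hecke_End n)" "m \<in> ?M" for \<phi> m
    using that by (auto simp: Hecke_End_carrier_iff)
  note defs = mirabolic_Schur_def conv_algebra_def mirabolic_tensor_def
    right_module_End_def[of _ _ "flag_conv _"]
  have mult: "End_symbol n (\<phi> \<otimes>\<^bsub>Hecke_End n\<^esub> \<psi>)
      = End_symbol n \<phi> \<otimes>\<^bsub>mirabolic_Schur n\<^esub> End_symbol n \<psi>"
    if "\<phi> \<in> carrier (Hecke_End n)" "\<psi> \<in> carrier (Hecke_End n)"
    for \<phi> \<psi> :: "('k, 'd) flag_fun \<Rightarrow> ('k, 'd) flag_fun"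
    using that
    by (intro End_symbol_left_mult)
      (simp_all add: defs End_symbol_invariant End_symbol_conv inM flag_conv_assoc
        flag_conv_invariant[OF stable_partial_flags])
  have add: "End_symbol n (\<phi> \<oplus>\<^bsub>Hecke_End n\<^esub> \<psi>)
      = End_symbol n \<phi> \<oplus>\<^bsub>mirabolic_Schur n\<^esub> End_symbol n \<psi>"
    if "\<phi> \<in> carrier (Hecke_End n)" "\<psi> \<in> carrier (Hecke_End n)"
    for \<phi> \<psi> :: "('k, 'd) flag_fun \<Rightarrow> ('k, 'd) flag_fun"
    using that
    by (intro End_symbol_left_mult)
      (simp_all add: defs End_symbol_invariant End_symbol_conv flag_conv_add_left
        invariant_functions_add)
  have smult: "End_symbol n (c \<odot>\<^bsub>Hecke_End n\<^esub> \<phi>) = c \<odot>\<^bsub>mirabolic_Schur n\<^esub> End_symbol n \<phi>"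
    if "\<phi> \<in> carrier (Hecke_End n)" for c and \<phi> :: "('k, 'd) flag_fun \<Rightarrow> ('k, 'd) flag_fun"
    using that
    by (intro End_symbol_left_mult)
      (simp_all add: defs End_symbol_invariant End_symbol_conv flag_conv_scale_left
        invariant_functions_scale)
  have one_eq: "\<one>\<^bsub>mirabolic_Schur n\<^esub> = (conv_unit (partial_flags n) :: ('k, 'd) flag_fun)"
    by (simp add: defs conv_unit_def)
  have one: "End_symbol n \<one>\<^bsub>Hecke_End n\<^esub>
      = (\<one>\<^bsub>mirabolic_Schur n\<^esub> :: ('k, 'd) flag_fun)"
    unfolding one_eq
  proof (rule End_symbol_left_mult)
    show "conv_unit (partial_flags n) \<in> ?U"
      by (subst conv_unit_split[symmetric])
        (intro invariant_functions_sum flag_conv_invariant[OF stable_complete_flags]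
          to_complete_invariant from_complete_invariant)
    show "\<one>\<^bsub>Hecke_End n\<^esub> m = flag_conv (partial_flags n) (conv_unit (partial_flags n)) m"
      if "m \<in> ?M" for m
      using that by (simp add: defs conv_unit_left finite_partial_flags)
  qed
  show ?thesis
    using bij_betw_End_symbol[of n, where 'k = 'k and 'd = 'd] mult add smult one
    by (auto simp: algebra_iso_def ring_iso_def ring_hom_def carrier End_symbol_invariant)
qed

theorem lemma6p6:
  fixes n :: nat
  assumes "n > 0"
  shows "\<exists>\<Phi>. \<Phi> \<in> algebra_iso
           (right_module_End
              (mirabolic_Hecke :: (complex, ('k::{finite,field}, 'd::finite) flag_fun) module)
              (mirabolic_tensor n :: (complex, ('k, 'd) flag_fun) module)
              (flag_conv complete_flags))
           (mirabolic_Schur n :: (complex, ('k, 'd) flag_fun) module)"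
  using End_symbol_algebra_iso by blast

end
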